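(* Suppose Assumption (U) of the context holds with $P\succ0$ as there. Partition $P=\begin{bmatrix}P_{11}&P_{21}^\top \\ P_{21}&P_{22}\end{bmatrix}$ with $P_{11}\in\mathbb R^{n_x\times n_x}$ and define $\mathcal P=P_{11}-P_{21}^\top P_{22}^{-1}P_{21}\succ0$ and $P_{\mathrm{diff}}=P_{11}-\mathcal P\succeq0$. Then there exist $\Gamma\in\mathbb R^{n_y\times n_y}$, $\Gamma\succ0$, and $\gamma>0$ satisfying $$N^\top\begin{bmatrix}-\rho^2P&0&0&0 \\ 0&P&0&0 \\ 0&0&M&0 \\ 0&0&0&-\Lambda\end{bmatrix}N\prec0,\qquad N=\begin{bmatrix}I&0&0 \\ \mathcal A&\mathcal B&\begin{bmatrix}B_G^d&0 \\ B_\Psi^yD_G^d&B_\Psi^y\end{bmatrix} \\ \mathcal C&\mathcal D&\begin{bmatrix}D_\Psi^yD_G^d&D_\Psi^y\end{bmatrix} \\ 0&0&I\end{bmatrix},\qquad \Lambda=\mathrm{diag}(\gamma\,\Xi,\Gamma),$$ and, for any such $\Gamma,\gamma$, any sequence $d\in\ell_{2e}^{n_d}$ with $d_t\in\mathbb D$ for all $t$, any $\xi_{0|\cdot}\in\ell_{2e}^{n_x}$, any $(v_{\cdot|t})_{t\in\mathbb N}$ with $v_{\cdot|t}\in\ell_{2e}^{n_u}$, and any initial condition $x_0\in\mathbb R^{n_x}$, the signals of the interconnection described in the context satisfy, for all $t\ge0$ and $k\ge0$, $$\|e_{k|t}\|_{\mathcal P}^2\le s_{k|t},$$ where $s_{0|0}=\|e_{0|0}\|_{P_{11}}^2$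 and $s_{k|t}$ is recursively defined by $$s_{k+1|t}=\rho^2s_{k|t}+\gamma d_{\max}^2+\|r_{k|t}\|_\Gamma^2$$ and, for $t\ge1$, $$s_{0|t}=s_{1|t-1}+\|e_{0|t}\|_{\mathcal P}^2-\|e_{1|t-1}\|_{\mathcal P}^2+\|e_{0|t}-e_{1|t-1}\|_{P_{\mathrm{diff}}}^2+2\|e_{0|t}-e_{1|t-1}\|_{P_{\mathrm{diff}}}\sqrt{s_{1|t-1}-\|e_{1|t-1}\|_{\mathcal P}^2}.$$
   Context: **Notation.** $\ell_{2e}^n$ is the set of all sequences $(q_k)_{k\in\mathbb N}$ in $\mathbb R^n$. For a positive (semi)definite $X$, $\|x\|_X^2=x^\top Xx$. The disturbance set is $\mathbb D=\{d\in\mathbb R^{n_d}:\|d\|_\Xi\le d_{\max}\}$ with $d_{\max}\ge0$, $\Xi\succ0$. **Interconnection.** Given are real matrices $A,B_G^w,B_G^d,B_G^u,C,D_G^w,D_G^d,D_G^u$ of compatible sizes, a gain $K\in\mathbb R^{n_u\times n_x}$, and a bounded causal operator $\Delta:\ell_{2e}^{n_y}\to\ell_{2e}^{n_w}$ such that the interconnection of $x_{t+1}=Ax_t+B_G^ww_t+B_G^dd_t+B_G^uu_t$, $y_t=Cx_t+D_G^ww_t+D_G^dd_t+D_G^uu_t$, $w=\Delta(y)$ is well-posed (unique response for all inputs $d,u$ and initial states). Put $A_G=A+B_G^uK$, $C_G=C+D_G^uK$. The index $k|t$ denotes a prediction $k$ steps ahead made at time $t$. For all $t,k\ge0$: - nominal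 system: $\xi_{k+1|t}=A\xi_{k|t}+B_G^uv_{k|t}$, $r_{k|t}=C\xi_{k|t}+D_G^uv_{k|t}$, with $\xi_{0|t}$ and $v_{\cdot|t}$ freely chosen; - possible true trajectories: $x_{k+1|t}=Ax_{k|t}+B_G^ww_{k|t}+B_G^dd_{k+t}+B_G^uu_{k|t}$, $y_{k|t}=Cx_{k|t}+D_G^ww_{k|t}+D_G^dd_{k+t}+D_G^uu_{k|t}$, $w_{k|t}=\Delta(y^{(t)})_{t+k}$, where $y^{(t)}_j=y_{0|j}$ for $0\le j<t$ (realized past) and $y^{(t)}_{t+k}=y_{k|t}$ for $k\ge0$; - error and input: $e_{k|t}=x_{k|t}-\xi_{k|t}$, $u_{k|t}=v_{k|t}+Ke_{k|t}$; - initialization: $x_{0|0}=x_0$, and the first input of each prediction is applied, i.e. $x_{0|t+1}=x_{1|t}$ (so $e_{0|t+1}=e_{1|t}-\xi_{0|t+1}+\xi_{1|t}$). Hence $e_{k+1|t}=A_Ge_{k|t}+B_G^ww_{k|t}+B_G^dd_{k+t}$ and $y_{k|t}=C_Ge_{k|t}+D_G^ww_{k|t}+D_G^dd_{k+t}+r_{k|t}$. **Filter and IQC.** $\Psi$ is a stable discrete-time LTI filter with realization $\psi_{t+1}=A_\Psi\psi_t+B_\Psi^yy_t+B_\Psi^ww_t$, $p_t=C_\Psi\psi_t+D_\Psi^yy_t+D_\Psi^ww_t$, and $M=M^\top\in\mathbb R^{n_p\times n_p}$. $\Delta$ satisfies the $\rho$-hard IQC defined by $(\Psi,M)$ if for all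 $y\in\ell_{2e}^{n_y}$ and all $T\ge1$, $\sum_{t=0}^{T-1}\rho^{-2t}p_t^\top Mp_t\ge0$, where $p$ is the filter output for inputs $y$, $w=\Delta(y)$ and $\psi_0=0$. Define $$\mathcal A=\begin{bmatrix}A_G&0 \\ B_\Psi^yC_G&A_\Psi\end{bmatrix},\ \mathcal B=\begin{bmatrix}B_G^w \\ B_\Psi^yD_G^w+B_\Psi^w\end{bmatrix},\ \mathcal C=\begin{bmatrix}D_\Psi^yC_G&C_\Psi\end{bmatrix},\ \mathcal D=D_\Psi^yD_G^w+D_\Psi^w.$$ **Assumption (U).** $\rho\in(0,1]$; $\Delta$ satisfies the $\rho$-hard IQC defined by $(\Psi,M)$; $\psi_0=0$; and there exists $P\succ0$ with $$\begin{bmatrix}I&0 \\ \mathcal A&\mathcal B \\ \mathcal C&\mathcal D\end{bmatrix}^\top\begin{bmatrix}-\rho^2P&0&0 \\ 0&P&0 \\ 0&0&M\end{bmatrix}\begin{bmatrix}I&0 \\ \mathcal A&\mathcal B \\ \mathcal C&\mathcal D\end{bmatrix}\prec0 .$$ *)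

theory Defs
  imports "HOL-Analysis.Analysis"
begin

definition hcat :: "real^'n^'m \<Rightarrow> real^'k^'m \<Rightarrow> real^('n + 'k)^'m" where
  "hcat A B = (\<chi> i j. case j of Inl j1 \<Rightarrow> A $ i $ j1 | Inr j2 \<Rightarrow> B $ i $ j2)"

definition vcat :: "real^'n^'m \<Rightarrow> real^'n^'k \<Rightarrow> real^'n^('m + 'k)" where
  "vcat A B = (\<chi> i. case i of Inl i1 \<Rightarrow> A $ i1 | Inr i2 \<Rightarrow> B $ i2)"

definition block_mat ::
  "real^'n^'m \<Rightarrow> real^'k^'m \<Rightarrow> real^'n^'l \<Rightarrow> real^'k^'l \<Rightarrow> real^('n + 'k)^('m + 'l)" where
  "block_mat A B C D = vcat (hcat A B) (hcat C D)"

definition block_diag :: "real^'n^'m \<Rightarrow> real^'k^'l \<Rightarrow> real^('n + 'k)^('m + 'l)" where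
  "block_diag A D = block_mat A 0 0 D"

definition symmetric_mat :: "real^'n^'n \<Rightarrow> bool" where
  "symmetric_mat X \<longleftrightarrow> transpose X = X"

definition wnorm_sq :: "real^'n^'n \<Rightarrow> real^'n \<Rightarrow> real" where
  "wnorm_sq X x = x \<bullet> (X *v x)"

definition wnorm :: "real^'n^'n \<Rightarrow> real^'n \<Rightarrow> real" where
  "wnorm X x = sqrt (wnorm_sq X x)"

text \<open>Definiteness always includes symmetry.\<close>

definition pos_def :: "real^'n^'n \<Rightarrow> bool" where
  "pos_def X \<longleftrightarrow> symmetric_mat X \<and> (\<forall>x. x \<noteq> 0 \<longrightarrow> x \<bullet> (X *v x) > 0)"

definition pos_semidef :: "real^'n^'n \<Rightarrow> bool" where
  "pos_semidef X \<longleftrightarrow> symmetric_mat X \<and> (\<forall>x. x \<bullet> (X *v x) \<ge> 0)"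

definition neg_def :: "real^'n^'n \<Rightarrow> bool" where
  "neg_def X \<longleftrightarrow> symmetric_mat X \<and> (\<forall>x. x \<noteq> 0 \<longrightarrow> x \<bullet> (X *v x) < 0)"

definition disturbance_set :: "real^'nd^'nd \<Rightarrow> real \<Rightarrow> (real^'nd) set" where
  "disturbance_set \<Xi> dmax = {d. wnorm \<Xi> d \<le> dmax}"

definition schur_stable :: "real^'n^'n \<Rightarrow> bool" where
  "schur_stable A \<longleftrightarrow>
    (\<forall>(z::complex) (v::complex^'n). v \<noteq> 0 \<longrightarrow> map_matrix complex_of_real A *v v = z *s v \<longrightarrow> cmod z < 1)"

definition causal_op :: "((nat \<Rightarrow> real^'ny) \<Rightarrow> (nat \<Rightarrow> real^'nw)) \<Rightarrow> bool" where
  "causal_op \<Delta> \<longleftrightarrow> (\<forall>y y' T. (\<forall>t\<le>T. y t = y' t) \<longrightarrow> (\<forall>t\<le>T. \<Delta> y t = \<Delta> y' t))"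

text \<open>Bounded means finite gain on all truncations to \<open>{0..T}\<close>.\<close>

definition bounded_op :: "((nat \<Rightarrow> real^'ny) \<Rightarrow> (nat \<Rightarrow> real^'nw)) \<Rightarrow> bool" where
  "bounded_op \<Delta> \<longleftrightarrow>
    (\<exists>c\<ge>0. \<forall>y T. sqrt (\<Sum>t\<le>T. (norm (\<Delta> y t))\<^sup>2) \<le> c * sqrt (\<Sum>t\<le>T. (norm (y t))\<^sup>2))"

definition well_posed ::
  "real^'nx^'nx \<Rightarrow> real^'nw^'nx \<Rightarrow> real^'nd^'nx \<Rightarrow> real^'nu^'nx \<Rightarrow>
   real^'nx^'ny \<Rightarrow> real^'nw^'ny \<Rightarrow> real^'nd^'ny \<Rightarrow> real^'nu^'ny \<Rightarrow>
   ((nat \<Rightarrow> real^'ny) \<Rightarrow> (nat \<Rightarrow> real^'nw)) \<Rightarrow> bool" where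
  "well_posed A Bw Bd Bu C Dw Dd Du \<Delta> \<longleftrightarrow>
    (\<forall>(d :: nat \<Rightarrow> real^'nd) (u :: nat \<Rightarrow> real^'nu) (x0 :: real^'nx).
      \<exists>!resp :: (nat \<Rightarrow> real^'nx) \<times> (nat \<Rightarrow> real^'ny) \<times> (nat \<Rightarrow> real^'nw).
        case resp of (x, y, w) \<Rightarrow>
          x 0 = x0 \<and>
          (\<forall>t. x (Suc t) = A *v x t + Bw *v w t + Bd *v d t + Bu *v u t) \<and>
          (\<forall>t. y t = C *v x t + Dw *v w t + Dd *v d t + Du *v u t) \<and>
          w = \<Delta> y)"

primrec filter_state ::
  "real^'ns^'ns \<Rightarrow> real^'ny^'ns \<Rightarrow> real^'nw^'ns \<Rightarrow>
   (nat \<Rightarrow> real^'ny) \<Rightarrow> (nat \<Rightarrow> real^'nw) \<Rightarrow> nat \<Rightarrow> real^'ns" where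
  "filter_state A By Bw y w 0 = 0"
| "filter_state A By Bw y w (Suc t) = A *v filter_state A By Bw y w t + By *v y t + Bw *v w t"

definition filter_output ::
  "real^'ns^'ns \<Rightarrow> real^'ny^'ns \<Rightarrow> real^'nw^'ns \<Rightarrow>
   real^'ns^'np \<Rightarrow> real^'ny^'np \<Rightarrow> real^'nw^'np \<Rightarrow>
   (nat \<Rightarrow> real^'ny) \<Rightarrow> (nat \<Rightarrow> real^'nw) \<Rightarrow> nat \<Rightarrow> real^'np" where
  "filter_output A By Bw C Dy Dw y w t =
    C *v filter_state A By Bw y w t + Dy *v y t + Dw *v w t"

definition hard_iqc ::
  "real \<Rightarrow> real^'ns^'ns \<Rightarrow> real^'ny^'ns \<Rightarrow> real^'nw^'ns \<Rightarrow>
   real^'ns^'np \<Rightarrow> real^'ny^'np \<Rightarrow> real^'nw^'np \<Rightarrow> real^'np^'np \<Rightarrow>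
   ((nat \<Rightarrow> real^'ny) \<Rightarrow> (nat \<Rightarrow> real^'nw)) \<Rightarrow> bool" where
  "hard_iqc \<rho> A By Bw C Dy Dw M \<Delta> \<longleftrightarrow>
    (\<forall>y. \<forall>T\<ge>1. (\<Sum>t<T. \<rho> powi (- 2 * int t) *
        (filter_output A By Bw C Dy Dw y (\<Delta> y) t \<bullet> (M *v filter_output A By Bw C Dy Dw y (\<Delta> y) t))) \<ge> 0)"

text \<open>Throughout, a predicted signal is written \<open>q k t\<close> for the value \<open>k\<close> steps ahead, predicted at
  time \<open>t\<close>. The sequence \<open>predicted_seq q t\<close> consists of the realized past \<open>q 0 j\<close> (\<open>j < t\<close>)
  followed by the prediction made at time \<open>t\<close>.\<close>

definition predicted_seq :: "(nat \<Rightarrow> nat \<Rightarrow> 'a) \<Rightarrow> nat \<Rightarrow> nat \<Rightarrow> 'a" where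
  "predicted_seq q t j = (if j < t then q 0 j else q (j - t) t)"

definition nominal_signals ::
  "real^'nx^'nx \<Rightarrow> real^'nu^'nx \<Rightarrow> real^'nx^'ny \<Rightarrow> real^'nu^'ny \<Rightarrow>
   (nat \<Rightarrow> real^'nx) \<Rightarrow> (nat \<Rightarrow> nat \<Rightarrow> real^'nu) \<Rightarrow>
   (nat \<Rightarrow> nat \<Rightarrow> real^'nx) \<Rightarrow> (nat \<Rightarrow> nat \<Rightarrow> real^'ny) \<Rightarrow> bool" where
  "nominal_signals A Bu C Du \<xi>0 v \<xi> r \<longleftrightarrow>
    (\<forall>t. \<xi> 0 t = \<xi>0 t) \<and>
    (\<forall>t k. \<xi> (Suc k) t = A *v \<xi> k t + Bu *v v k t) \<and>
    (\<forall>t k. r k t = C *v \<xi> k t + Du *v v k t)"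

definition true_signals ::
  "real^'nx^'nx \<Rightarrow> real^'nw^'nx \<Rightarrow> real^'nd^'nx \<Rightarrow> real^'nu^'nx \<Rightarrow>
   real^'nx^'ny \<Rightarrow> real^'nw^'ny \<Rightarrow> real^'nd^'ny \<Rightarrow> real^'nu^'ny \<Rightarrow>
   ((nat \<Rightarrow> real^'ny) \<Rightarrow> (nat \<Rightarrow> real^'nw)) \<Rightarrow>
   (nat \<Rightarrow> real^'nd) \<Rightarrow> real^'nx \<Rightarrow>
   (nat \<Rightarrow> nat \<Rightarrow> real^'nu) \<Rightarrow> (nat \<Rightarrow> nat \<Rightarrow> real^'nx) \<Rightarrow>
   (nat \<Rightarrow> nat \<Rightarrow> real^'ny) \<Rightarrow> (nat \<Rightarrow> nat \<Rightarrow> real^'nw) \<Rightarrow> bool" where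
  "true_signals A Bw Bd Bu C Dw Dd Du \<Delta> d x0 u x y w \<longleftrightarrow>
    (\<forall>t k. x (Suc k) t = A *v x k t + Bw *v w k t + Bd *v d (k + t) + Bu *v u k t) \<and>
    (\<forall>t k. y k t = C *v x k t + Dw *v w k t + Dd *v d (k + t) + Du *v u k t) \<and>
    (\<forall>t k. w k t = \<Delta> (predicted_seq y t) (t + k)) \<and>
    x 0 0 = x0 \<and>
    (\<forall>t. x 0 (Suc t) = x 1 t)"

fun error_bound ::
  "real \<Rightarrow> real \<Rightarrow> real \<Rightarrow> real^'ny^'ny \<Rightarrow>
   real^'nx^'nx \<Rightarrow> real^'nx^'nx \<Rightarrow> real^'nx^'nx \<Rightarrow>
   (nat \<Rightarrow> nat \<Rightarrow> real^'nx) \<Rightarrow> (nat \<Rightarrow> nat \<Rightarrow> real^'ny) \<Rightarrow> nat \<Rightarrow> nat \<Rightarrow> real" where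
  "error_bound \<rho> \<gamma> dmax \<Gamma> P11 Pcal Pdiff e r (Suc k) t =
    \<rho>\<^sup>2 * error_bound \<rho> \<gamma> dmax \<Gamma> P11 Pcal Pdiff e r k t + \<gamma> * dmax\<^sup>2 + wnorm_sq \<Gamma> (r k t)"
| "error_bound \<rho> \<gamma> dmax \<Gamma> P11 Pcal Pdiff e r 0 0 = wnorm_sq P11 (e 0 0)"
| "error_bound \<rho> \<gamma> dmax \<Gamma> P11 Pcal Pdiff e r 0 (Suc t) =
    error_bound \<rho> \<gamma> dmax \<Gamma> P11 Pcal Pdiff e r 1 t
    + wnorm_sq Pcal (e 0 (Suc t)) - wnorm_sq Pcal (e 1 t)
    + wnorm_sq Pdiff (e 0 (Suc t) - e 1 t)
    + 2 * wnorm Pdiff (e 0 (Suc t) - e 1 t)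
        * sqrt (error_bound \<rho> \<gamma> dmax \<Gamma> P11 Pcal Pdiff e r 1 t - wnorm_sq Pcal (e 1 t))"

end

theory Submission
  imports Defs
begin

text \<open>The IQC enters only through the accumulated supply, a weighted sum that is nonnegative. Adding it to
  the storage function \<open>wnorm_sq P (e, \<psi>)\<close> gives a quantity which the linear matrix inequality
  makes decrease along each prediction up to the disturbance terms. Completing the square splits the storage
  function into \<open>wnorm_sq Pcal e\<close> and a \<open>P22\<close>-norm of a shifted filter state. When the
  nominal state is reset, causality keeps the filter state and the supply unchanged, so that only the error
  jumps and the shifted filter state is controlled by the triangle inequality. The multipliers exist because
  a quadratic form that is negative on the kernel of a nonnegative one stays negative after subtracting
  a large multiple of it.\<close>

section \<open>Block vectors and block matrices\<close>

text \<open>Counterpart of \<open>hcat\<close> and \<open>vcat\<close> for vectors: the sum type as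
  index set lets the block matrices of the theorem be evaluated one block row at a time.\<close>

definition vjoin :: "'a^'m \<Rightarrow> 'a^'k \<Rightarrow> 'a^('m + 'k)" where
  "vjoin x y = (\<chi> i. case i of Inl a \<Rightarrow> x $ a | Inr b \<Rightarrow> y $ b)"

lemma vjoin_nth [simp]: "vjoin x y $ Inl a = x $ a" "vjoin x y $ Inr b = y $ b"
  by (simp_all add: vjoin_def)

lemma vec_sum_eq_iff:
  fixes z z' :: "'a^('m::finite + 'k::finite)"
  shows "z = z' \<longleftrightarrow> (\<forall>a. z $ Inl a = z' $ Inl a) \<and> (\<forall>b. z $ Inr b = z' $ Inr b)"
  by (simp add: vec_eq_iff split_sum_all)

lemma vjoin_surj: obtains x y where "z = vjoin x y"
proof
  show "z = vjoin (\<chi> a. z $ Inl a) (\<chi> b. z $ Inr b)"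
    by (simp add: vec_sum_eq_iff)
qed

lemma vjoin_add: "vjoin x y + vjoin x' y' = vjoin (x + x') (y + y')"
  by (simp add: vec_sum_eq_iff)

lemma vjoin_eq_0_iff: "vjoin x y = 0 \<longleftrightarrow> x = 0 \<and> y = 0"
  by (simp add: vec_sum_eq_iff) (simp add: vec_eq_iff)

lemma sum_UNIV_Plus:
  "(\<Sum>i\<in>UNIV. f i) = (\<Sum>a\<in>UNIV. f (Inl a)) + (\<Sum>b\<in>UNIV. f (Inr b))"
  for f :: "'m::finite + 'k::finite \<Rightarrow> 'a::comm_monoid_add"
  by (simp add: UNIV_Plus_UNIV[symmetric] sum.Plus del: UNIV_Plus_UNIV)

lemma inner_vjoin [simp]: "vjoin x y \<bullet> vjoin x' y' = x \<bullet> x' + y \<bullet> y'"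
  by (simp add: inner_vec_def sum_UNIV_Plus)

lemma hcat_mult_vjoin [simp]: "hcat A B *v vjoin x y = A *v x + B *v y"
  by (simp add: vec_eq_iff matrix_vector_mult_def hcat_def sum_UNIV_Plus)

lemma vcat_mult [simp]: "vcat A B *v x = vjoin (A *v x) (B *v x)"
  by (simp add: vec_sum_eq_iff matrix_vector_mult_def vcat_def)

lemma block_mat_mult_vjoin [simp]:
  "block_mat A B C D *v vjoin x y = vjoin (A *v x + B *v y) (C *v x + D *v y)"
  by (simp add: block_mat_def)

lemma block_diag_mult_vjoin [simp]: "block_diag A D *v vjoin x y = vjoin (A *v x) (D *v y)"
  by (simp add: block_diag_def)

lemma block_mat_nth [simp]:
  "block_mat A B C D $ Inl a $ Inl a' = A $ a $ a'"
  "block_mat A B C D $ Inl a $ Inr b' = B $ a $ b'"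
  "block_mat A B C D $ Inr b $ Inl a' = C $ b $ a'"
  "block_mat A B C D $ Inr b $ Inr b' = D $ b $ b'"
  by (simp_all add: block_mat_def vcat_def hcat_def)

lemma symmetric_mat_nth: "symmetric_mat X \<longleftrightarrow> (\<forall>i j. X $ i $ j = X $ j $ i)"
  by (auto simp: symmetric_mat_def vec_eq_iff transpose_def)

lemma symmetric_block_mat_iff:
  "symmetric_mat (block_mat A B C D) \<longleftrightarrow> symmetric_mat A \<and> symmetric_mat D \<and> B = transpose C"
  by (auto simp: symmetric_mat_nth vec_eq_iff transpose_def split_sum_all)

lemma symmetric_block_diag: "symmetric_mat A \<Longrightarrow> symmetric_mat D \<Longrightarrow> symmetric_mat (block_diag A D)"
  unfolding block_diag_def symmetric_block_mat_iff by (simp add: vec_eq_iff transpose_def)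

lemma symmetric_scaleR: "symmetric_mat X \<Longrightarrow> symmetric_mat (c *\<^sub>R X)"
  by (simp add: symmetric_mat_nth)

lemma symmetric_uminus: "symmetric_mat X \<Longrightarrow> symmetric_mat (- X)"
  by (simp add: symmetric_mat_nth)

lemma symmetric_diff: "symmetric_mat X \<Longrightarrow> symmetric_mat Y \<Longrightarrow> symmetric_mat (X - Y)"
  by (simp add: symmetric_mat_nth)

lemma symmetric_congruence:
  assumes "symmetric_mat X" shows "symmetric_mat (transpose N ** X ** N)"
  using assms by (simp add: symmetric_mat_def matrix_transpose_mul matrix_mul_assoc)

section \<open>Quadratic forms\<close>

lemma inner_transpose_mult: "x \<bullet> (transpose N *v y) = (N *v x) \<bullet> y"
  for N :: "real^'n^'m"
  by (metis dot_lmul_matrix inner_commute transpose_matrix_vector)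

lemma inner_symmetric: "symmetric_mat X \<Longrightarrow> x \<bullet> (X *v y) = (X *v x) \<bullet> y"
  using inner_transpose_mult[of x X y] by (simp add: symmetric_mat_def)

lemma wnorm_sq_congruence: "wnorm_sq (transpose N ** X ** N) x = wnorm_sq X (N *v x)"
  unfolding wnorm_sq_def by (simp only: inner_transpose_mult flip: matrix_vector_mul_assoc)

lemma wnorm_sq_add:
  "symmetric_mat X \<Longrightarrow> wnorm_sq X (x + y) = wnorm_sq X x + 2 * (x \<bullet> (X *v y)) + wnorm_sq X y"
  using inner_symmetric[of X y x] inner_commute[of x "X *v y"]
  by (simp add: wnorm_sq_def matrix_vector_right_distrib inner_add_left inner_add_right)

lemma wnorm_sq_scaleR_right: "wnorm_sq X (c *\<^sub>R x) = c\<^sup>2 * wnorm_sq X x"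
  by (simp add: wnorm_sq_def matrix_vector_mult_scaleR power2_eq_square)

lemma wnorm_sq_scaleR: "wnorm_sq (c *\<^sub>R X) x = c * wnorm_sq X x"
  by (simp add: wnorm_sq_def flip: scaleR_matrix_vector_assoc)

lemma wnorm_sq_uminus: "wnorm_sq (- X) x = - wnorm_sq X x"
  using wnorm_sq_scaleR[of "-1" X x] by simp

lemma wnorm_sq_block_diag: "wnorm_sq (block_diag A D) (vjoin x y) = wnorm_sq A x + wnorm_sq D y"
  by (simp add: wnorm_sq_def)

lemma pos_def_wnorm_sq_pos: "pos_def X \<Longrightarrow> x \<noteq> 0 \<Longrightarrow> wnorm_sq X x > 0"
  by (simp add: pos_def_def wnorm_sq_def)

lemma pos_def_wnorm_sq_nonneg: "pos_def X \<Longrightarrow> wnorm_sq X x \<ge> 0"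
  by (cases "x = 0") (auto simp: wnorm_sq_def pos_def_def less_imp_le)

text \<open>The form is nonnegative along the line through \<open>x\<close> in direction
  \<open>y\<close>; its minimum there has nonnegative value exactly when the squared inequality
  holds.\<close>

lemma pos_def_Cauchy_Schwarz:
  assumes X: "pos_def X"
  shows "x \<bullet> (X *v y) \<le> wnorm X x * wnorm X y"
proof (cases "y = 0")
  case False
  define b c where "b = x \<bullet> (X *v y)" and "c = wnorm_sq X y"
  have c: "c > 0" using False X by (simp add: c_def pos_def_wnorm_sq_pos)
  have sym: "symmetric_mat X" using X by (simp add: pos_def_def)
  \<comment> \<open>The coefficient \<open>- b / c\<close> minimises the quadratic polynomial
    \<open>s \<mapsto> wnorm_sq X (x + s y)\<close>.\<close>
  have "0 \<le> wnorm_sq X (x + (- b / c) *\<^sub>R y)"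
    by (rule pos_def_wnorm_sq_nonneg[OF X])
  also have "\<dots> = wnorm_sq X x + 2 * ((- b / c) * b) + (- b / c)\<^sup>2 * c"
    unfolding wnorm_sq_add[OF sym] wnorm_sq_scaleR_right matrix_vector_mult_scaleR inner_scaleR_right
    by (simp add: b_def c_def)
  also have "\<dots> = wnorm_sq X x - b\<^sup>2 / c"
    using c by (simp add: field_simps power2_eq_square)
  finally have "b\<^sup>2 \<le> wnorm_sq X x * c" using c by (simp add: field_simps)
  then have "sqrt (b\<^sup>2) \<le> sqrt (wnorm_sq X x * c)" by (rule real_sqrt_le_mono)
  then show ?thesis by (simp add: b_def c_def wnorm_def real_sqrt_mult)
qed (simp add: wnorm_def wnorm_sq_def)

lemma wnorm_sq_add_le:
  assumes "pos_def X"
  shows "wnorm_sq X (x + y) \<le> wnorm_sq X x + 2 * wnorm X x * wnorm X y + wnorm_sq X y"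
  using wnorm_sq_add[of X x y] pos_def_Cauchy_Schwarz[OF assms, of x y] assms
  by (simp add: pos_def_def)

lemma continuous_on_wnorm_sq: "continuous_on S (wnorm_sq X)"
  unfolding wnorm_sq_def
  by (intro continuous_on_inner continuous_on_id matrix_vector_mult_linear_continuous_on)

text \<open>Finsler's lemma by compactness. Only unit vectors at which \<open>X\<close> is
  nonnegative matter; they form a compact set on which \<open>Y\<close> cannot vanish, so
  \<open>Y\<close> has a positive minimum there. Homogeneity extends the estimate to all nonzero
  vectors.\<close>

lemma dominate_quadratic_form:
  fixes X Y :: "real^'n^'n"
  assumes Y: "\<And>x. wnorm_sq Y x \<ge> 0"
    and X: "\<And>x. x \<noteq> 0 \<Longrightarrow> wnorm_sq Y x = 0 \<Longrightarrow> wnorm_sq X x < 0"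
  obtains c where "c > 0" "\<And>x. x \<noteq> 0 \<Longrightarrow> wnorm_sq X x < c * wnorm_sq Y x"
proof -
  define S where "S = sphere 0 1 \<inter> {x. wnorm_sq X x \<ge> 0}"
  have "closed {x. wnorm_sq X x \<ge> 0}"
    by (intro closed_Collect_le continuous_on_wnorm_sq continuous_on_const)
  then have S: "compact S" unfolding S_def by (intro compact_Int_closed) auto
  obtain c where c: "c > 0" "\<And>x. x \<in> S \<Longrightarrow> wnorm_sq X x < c * wnorm_sq Y x"
  proof (cases "S = {}")
    case True
    then show ?thesis using that[of 1] by auto
  next
    case False
    obtain a where a: "a \<in> S" "\<And>x. x \<in> S \<Longrightarrow> wnorm_sq Y a \<le> wnorm_sq Y x"
      using continuous_attains_inf[OF S False continuous_on_wnorm_sq] by blast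
    obtain b where b: "b \<in> S" "\<And>x. x \<in> S \<Longrightarrow> wnorm_sq X x \<le> wnorm_sq X b"
      using continuous_attains_sup[OF S False continuous_on_wnorm_sq] by blast
    define m F where "m = wnorm_sq Y a" and "F = wnorm_sq X b"
    have "a \<noteq> 0" using a(1) by (auto simp: S_def)
    then have m: "m > 0" using X[of a] Y[of a] a(1) by (force simp: m_def S_def)
    have F: "F \<ge> 0" using b(1) by (simp add: F_def S_def)
    show ?thesis
    \<comment> \<open>\<open>F\<close> bounds \<open>X\<close> from above on \<open>S\<close> and
      \<open>m\<close> bounds \<open>Y\<close> from below; the summand 1 makes the estimate strict
      and the constant positive even if \<open>F = 0\<close>.\<close>
    proof (rule that[of "F / m + 1"])
      show "F / m + 1 > 0" using F m by (simp add: add_nonneg_pos)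
      fix x assume x: "x \<in> S"
      have "wnorm_sq X x \<le> F" using b(2)[OF x] by (simp add: F_def)
      also have "\<dots> < (F / m + 1) * m" using m by (simp add: field_simps)
      also have "\<dots> \<le> (F / m + 1) * wnorm_sq Y x"
        using a(2)[OF x] F m by (intro mult_left_mono) (simp_all add: m_def)
      finally show "wnorm_sq X x < (F / m + 1) * wnorm_sq Y x" .
    qed
  qed
  have "wnorm_sq X x < c * wnorm_sq Y x" if "x \<noteq> 0" for x
  proof -
    define s where "s = inverse (norm x) *\<^sub>R x"
    have s: "norm s = 1" and x: "x = norm x *\<^sub>R s" using that by (simp_all add: s_def)
    have "wnorm_sq X s < c * wnorm_sq Y s"
    proof (cases "wnorm_sq X s \<ge> 0")
      case True
      then show ?thesis using c(2)[of s] s by (simp add: S_def)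
    next
      case False
      then show ?thesis using c(1) Y[of s] by (smt (verit) mult_nonneg_nonneg)
    qed
    then have "(norm x)\<^sup>2 * wnorm_sq X s < (norm x)\<^sup>2 * (c * wnorm_sq Y s)"
      using that by simp
    moreover have "wnorm_sq Z x = (norm x)\<^sup>2 * wnorm_sq Z s" for Z
      using wnorm_sq_scaleR_right[of Z "norm x" s] x by simp
    ultimately show ?thesis by (simp add: algebra_simps)
  qed
  then show ?thesis using that c(1) by blast
qed

section \<open>Schur complements\<close>

text \<open>A definite matrix has trivial kernel, hence a left inverse, which for a square matrix is
  two-sided; this supplies the existence needed for the choice in \<open>matrix_inv\<close>.\<close>

lemma pos_def_matrix_inv:
  assumes "pos_def X"
  shows "X ** matrix_inv X = mat 1"
proof -
  have "\<forall>x. X *v x = 0 \<longrightarrow> x = 0"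
    using assms by (force simp: pos_def_def)
  then have "\<exists>Y. X ** Y = mat 1 \<and> Y ** X = mat 1"
    by (metis matrix_left_invertible_ker matrix_left_right_inverse)
  then have "X ** matrix_inv X = mat 1 \<and> matrix_inv X ** X = mat 1"
    unfolding matrix_inv_def by (rule someI_ex)
  then show ?thesis ..
qed

lemma pos_def_block_matD:
  assumes "pos_def (block_mat P11 (transpose P21) P21 P22)"
  shows "symmetric_mat P11" "pos_def P22"
proof -
  show "symmetric_mat P11" using assms by (simp add: pos_def_def symmetric_block_mat_iff)
  have "wnorm_sq P22 x > 0" if "x \<noteq> 0" for x
    using pos_def_wnorm_sq_pos[OF assms, of "vjoin 0 x"] that
    by (simp add: wnorm_sq_def vjoin_eq_0_iff)
  then show "pos_def P22"
    using assms by (simp add: pos_def_def symmetric_block_mat_iff wnorm_sq_def)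
qed

text \<open>Completing the square in the second block: since \<open>P22 ** G = P21\<close>, the
  mixed term and the subtracted Schur term combine into the square of the shifted vector
  \<open>y + G *v x\<close>.\<close>

lemma schur_complement:
  fixes P11 :: "real^'n^'n" and P21 :: "real^'n^'m" and P22 :: "real^'m^'m"
  assumes P22: "pos_def P22"
    and G: "G = matrix_inv P22 ** P21"
  shows schur_complement_diff: "transpose P21 ** matrix_inv P22 ** P21 = transpose G ** P22 ** G"
    and schur_complement_split: "wnorm_sq (block_mat P11 (transpose P21) P21 P22) (vjoin x y) =
      wnorm_sq (P11 - transpose P21 ** matrix_inv P22 ** P21) x + wnorm_sq P22 (y + G *v x)"
proof -
  have PG: "P22 ** G = P21"
    using pos_def_matrix_inv[OF P22] by (simp add: G matrix_mul_assoc)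
  have sym: "symmetric_mat P22" using P22 by (simp add: pos_def_def)
  then have GP: "transpose P21 = transpose G ** P22"
    by (metis PG matrix_transpose_mul symmetric_mat_def)
  show diff: "transpose P21 ** matrix_inv P22 ** P21 = transpose G ** P22 ** G"
    unfolding GP[symmetric] by (simp add: G matrix_mul_assoc)
  have "wnorm_sq (P11 - transpose P21 ** matrix_inv P22 ** P21) x = wnorm_sq P11 x - wnorm_sq P22 (G *v x)"
    unfolding diff wnorm_sq_congruence[symmetric]
    by (simp add: wnorm_sq_def matrix_vector_mult_diff_rdistrib inner_diff_right)
  moreover have "y \<bullet> (P21 *v x) = y \<bullet> (P22 *v (G *v x))"
    by (simp add: PG matrix_vector_mul_assoc)
  moreover have "x \<bullet> (transpose P21 *v y) = y \<bullet> (P21 *v x)"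
    by (simp only: inner_transpose_mult inner_commute)
  ultimately show "wnorm_sq (block_mat P11 (transpose P21) P21 P22) (vjoin x y) =
      wnorm_sq (P11 - transpose P21 ** matrix_inv P22 ** P21) x + wnorm_sq P22 (y + G *v x)"
    unfolding wnorm_sq_add[OF sym]
    by (simp only: wnorm_sq_def block_mat_mult_vjoin inner_vjoin inner_add_right)
qed

text \<open>For given \<open>x\<close>, the choice \<open>y = - (G *v x)\<close> annihilates the
  square in the split, so the Schur complement inherits positivity from the whole block
  matrix.\<close>

lemma pos_def_schur_complement:
  assumes "pos_def (block_mat P11 (transpose P21) P21 P22)"
  shows "pos_def (P11 - transpose P21 ** matrix_inv P22 ** P21)"
proof -
  define G where "G = matrix_inv P22 ** P21"
  note P22 = pos_def_block_matD(2)[OF assms]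
  have "symmetric_mat (P11 - transpose P21 ** matrix_inv P22 ** P21)"
    unfolding schur_complement_diff[OF P22 G_def] using P22
    by (intro symmetric_diff symmetric_congruence pos_def_block_matD[OF assms]) (simp add: pos_def_def)
  moreover have "wnorm_sq (P11 - transpose P21 ** matrix_inv P22 ** P21) x > 0" if "x \<noteq> 0" for x
  proof -
    have "wnorm_sq (block_mat P11 (transpose P21) P21 P22) (vjoin x (- (G *v x))) > 0"
      using that by (intro pos_def_wnorm_sq_pos assms) (simp add: vjoin_eq_0_iff)
    then show ?thesis by (simp add: schur_complement_split[OF P22 G_def]) (simp add: wnorm_sq_def)
  qed
  ultimately show ?thesis by (simp add: pos_def_def wnorm_sq_def)
qed

lemma pos_semidef_congruence:
  assumes "pos_def X" shows "pos_semidef (transpose G ** X ** G)"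
proof -
  have "wnorm_sq (transpose G ** X ** G) x \<ge> 0" for x
    by (simp add: wnorm_sq_congruence pos_def_wnorm_sq_nonneg[OF assms])
  then show ?thesis
    using assms symmetric_congruence unfolding pos_semidef_def pos_def_def wnorm_sq_def by blast
qed

text \<open>Effect of moving the error from \<open>a\<close> to \<open>b\<close> while the filter
  state \<open>y\<close> and the accumulated supply \<open>q\<close> stay fixed. The shifted filter
  state moves by \<open>h = G *v (b - a)\<close>, whose \<open>P22\<close>-norm is the
  \<open>Pdiff\<close>-norm of the jump; the right-hand side is the recursion for the bound at a
  reset.\<close>

lemma storage_reset:
  assumes P: "pos_def (block_mat P11 (transpose P21) P21 P22)"
    and Pcal: "Pcal = P11 - transpose P21 ** matrix_inv P22 ** P21"
    and Pdiff: "Pdiff = P11 - Pcal"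
    and le: "wnorm_sq (block_mat P11 (transpose P21) P21 P22) (vjoin a y) + q \<le> s" and q: "q \<ge> 0"
  shows "wnorm_sq (block_mat P11 (transpose P21) P21 P22) (vjoin b y) + q \<le>
    s + wnorm_sq Pcal b - wnorm_sq Pcal a + wnorm_sq Pdiff (b - a) +
    2 * wnorm Pdiff (b - a) * sqrt (s - wnorm_sq Pcal a)"
proof -
  define G where "G = matrix_inv P22 ** P21"
  note P22 = pos_def_block_matD(2)[OF P]
  note split = schur_complement_split[OF P22 G_def, where ?P11.0 = P11, folded Pcal]
  define g where "g = y + G *v a"
  define h where "h = G *v (b - a)"
  have "Pdiff = transpose G ** P22 ** G"
    by (simp add: Pdiff Pcal schur_complement_diff[OF P22 G_def])
  then have sq: "wnorm_sq Pdiff (b - a) = wnorm_sq P22 h"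
    by (simp add: wnorm_sq_congruence h_def)
  then have nrm: "wnorm Pdiff (b - a) = wnorm P22 h" by (simp add: wnorm_def)
  have "y + G *v b = g + h" by (simp add: g_def h_def matrix_vector_mult_diff_distrib)
  then have new: "wnorm_sq P22 (y + G *v b) \<le> wnorm_sq P22 g + 2 * wnorm P22 g * wnorm P22 h + wnorm_sq P22 h"
    using wnorm_sq_add_le[OF P22] by simp
  have old: "wnorm_sq P22 g + q \<le> s - wnorm_sq Pcal a"
    using le unfolding split g_def by simp
  \<comment> \<open>The supply is discarded only under the root; \<open>old\<close> keeps it, so it
    survives in the conclusion and is available for the next prediction.\<close>
  then have "wnorm P22 g \<le> sqrt (s - wnorm_sq Pcal a)"
    using q by (simp add: wnorm_def)
  then have "2 * wnorm P22 g * wnorm P22 h \<le> 2 * sqrt (s - wnorm_sq Pcal a) * wnorm P22 h"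
    by (intro mult_right_mono) (simp_all add: wnorm_def pos_def_wnorm_sq_nonneg[OF P22])
  then show ?thesis
    using new old unfolding split sq nrm by (simp add: mult_ac)
qed

section \<open>Accumulated supply\<close>

text \<open>The sum of \<rho>^(2(T-1-t)) m(t) over t < T. This scaling of the IQC sum obeys a
  recursion with the same factor \<rho>^2 as the storage function, so the two can be added.\<close>

primrec acc_supply :: "real \<Rightarrow> (nat \<Rightarrow> real) \<Rightarrow> nat \<Rightarrow> real" where
  "acc_supply \<rho> m 0 = 0"
| "acc_supply \<rho> m (Suc T) = \<rho>\<^sup>2 * acc_supply \<rho> m T + m T"

text \<open>The extra factor \<rho>^2 on the left avoids the exponent 2(T-1), which would involve
  truncated subtraction at T = 0.\<close>

lemma acc_supply_eq_sum:
  assumes "\<rho> \<noteq> 0"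
  shows "\<rho>\<^sup>2 * acc_supply \<rho> m T = \<rho> ^ (2 * T) * (\<Sum>t<T. \<rho> powi (- 2 * int t) * m t)"
proof (induction T)
  case (Suc T)
  have "\<rho> ^ (2 * T) * \<rho> powi (- 2 * int T) = 1"
    using assms power_int_add[of \<rho> "int (2 * T)" "- 2 * int T"] by (simp flip: power_int_of_nat)
  then have "\<rho> ^ (2 * Suc T) * (\<rho> powi (- 2 * int T) * m T) = \<rho>\<^sup>2 * m T"
    by (simp add: power2_eq_square algebra_simps)
  then show ?case
    using Suc.IH by (simp add: algebra_simps power2_eq_square)
qed simp

lemma acc_supply_nonneg:
  assumes iqc: "hard_iqc \<rho> A By Bw C Dy Dw M \<Delta>" and \<rho>: "\<rho> > 0"
  shows "acc_supply \<rho> (\<lambda>t. wnorm_sq M (filter_output A By Bw C Dy Dw y (\<Delta> y) t)) T \<ge> 0"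
proof (cases "T = 0")
  case False
  then have "(\<Sum>t<T. \<rho> powi (- 2 * int t) *
      wnorm_sq M (filter_output A By Bw C Dy Dw y (\<Delta> y) t)) \<ge> 0"
    using iqc by (simp add: hard_iqc_def wnorm_sq_def)
  then have "\<rho>\<^sup>2 * acc_supply \<rho> (\<lambda>t. wnorm_sq M (filter_output A By Bw C Dy Dw y (\<Delta> y) t)) T \<ge> 0"
    using \<rho> by (simp add: acc_supply_eq_sum)
  then show ?thesis using \<rho> by (simp add: zero_le_mult_iff)
qed simp

lemma acc_supply_cong: "(\<And>t. t < T \<Longrightarrow> m t = m' t) \<Longrightarrow> acc_supply \<rho> m T = acc_supply \<rho> m' T"
  by (induction T) auto

section \<open>Dependence on the past: filter and predicted sequences\<close>

lemma filter_state_cong: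
  "(\<And>t. t < T \<Longrightarrow> y t = y' t \<and> w t = w' t) \<Longrightarrow> filter_state A By Bw y w T = filter_state A By Bw y' w' T"
  by (induction T) auto

text \<open>Because of the feedthrough terms the output also depends on the inputs at time
  \<open>T\<close> itself, whereas the state sees only earlier ones.\<close>

lemma filter_output_cong:
  "(\<And>t. t \<le> T \<Longrightarrow> y t = y' t \<and> w t = w' t) \<Longrightarrow>
    filter_output A By Bw C Dy Dw y w T = filter_output A By Bw C Dy Dw y' w' T"
  unfolding filter_output_def using filter_state_cong[of T y y' w w' A By Bw] by auto

text \<open>The range includes \<open>j = t\<close>: the first value of the prediction made at
  \<open>t\<close> is the one that becomes realized past at the next time.\<close>

lemma predicted_seq_Suc: "j \<le> t \<Longrightarrow> predicted_seq q (Suc t) j = predicted_seq q t j"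
  by (auto simp: predicted_seq_def)

lemma predicted_seq_add [simp]: "predicted_seq q t (t + k) = q k t"
  by (simp add: predicted_seq_def)

theorem theorem4:
  fixes A :: "real^'nx^'nx" and BGw :: "real^'nw^'nx" and BGd :: "real^'nd^'nx" and BGu :: "real^'nu^'nx"
    and C :: "real^'nx^'ny" and DGw :: "real^'nw^'ny" and DGd :: "real^'nd^'ny" and DGu :: "real^'nu^'ny"
    and K :: "real^'nx^'nu"
    and \<Delta> :: "(nat \<Rightarrow> real^'ny) \<Rightarrow> (nat \<Rightarrow> real^'nw)"
    and A\<Psi> :: "real^'ns^'ns" and B\<Psi>y :: "real^'ny^'ns" and B\<Psi>w :: "real^'nw^'ns"
    and C\<Psi> :: "real^'ns^'np" and D\<Psi>y :: "real^'ny^'np" and D\<Psi>w :: "real^'nw^'np"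
    and M :: "real^'np^'np"
    and \<Xi> :: "real^'nd^'nd" and dmax \<rho> :: real
    and AG :: "real^'nx^'nx" and CG :: "real^'nx^'ny"
    and \<A> :: "real^('nx + 'ns)^('nx + 'ns)" and \<B> :: "real^'nw^('nx + 'ns)"
    and \<C> :: "real^('nx + 'ns)^'np" and \<D> :: "real^'nw^'np"
    and P :: "real^('nx + 'ns)^('nx + 'ns)"
    and P11 :: "real^'nx^'nx" and P21 :: "real^'nx^'ns" and P22 :: "real^'ns^'ns"
    and Pcal Pdiff :: "real^'nx^'nx"
    and L :: "real^(('nx + 'ns) + 'nw)^(('nx + 'ns) + (('nx + 'ns) + 'np))"
    and N :: "real^(('nx + 'ns) + ('nw + ('nd + 'ny)))^(('nx + 'ns) + (('nx + 'ns) + ('np + ('nd + 'ny))))"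
    and LMI :: "real^'ny^'ny \<Rightarrow> real \<Rightarrow> bool"
  assumes dmax: "dmax \<ge> 0" and \<Xi>: "pos_def \<Xi>"
    and \<Delta>: "causal_op \<Delta>" "bounded_op \<Delta>"
    and well_posed: "well_posed A BGw BGd BGu C DGw DGd DGu \<Delta>"
    and AG: "AG = A + BGu ** K" and CG: "CG = C + DGu ** K"
    and stable: "schur_stable A\<Psi>" and M: "symmetric_mat M"
    and \<A>: "\<A> = block_mat AG 0 (B\<Psi>y ** CG) A\<Psi>"
    and \<B>: "\<B> = vcat BGw (B\<Psi>y ** DGw + B\<Psi>w)"
    and \<C>: "\<C> = hcat (D\<Psi>y ** CG) C\<Psi>"
    and \<D>: "\<D> = D\<Psi>y ** DGw + D\<Psi>w"
    and \<rho>: "0 < \<rho>" "\<rho> \<le> 1"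
    and iqc: "hard_iqc \<rho> A\<Psi> B\<Psi>y B\<Psi>w C\<Psi> D\<Psi>y D\<Psi>w M \<Delta>"
    and P: "pos_def P"
    and L: "L = vcat (hcat (mat 1) 0) (vcat (hcat \<A> \<B>) (hcat \<C> \<D>))"
    and U: "neg_def (transpose L ** block_diag (- (\<rho>\<^sup>2 *\<^sub>R P)) (block_diag P M) ** L)"
    and P_partition: "P = block_mat P11 (transpose P21) P21 P22"
    and Pcal: "Pcal = P11 - transpose P21 ** matrix_inv P22 ** P21"
    and Pdiff: "Pdiff = P11 - Pcal"
    and N: "N = vcat (hcat (mat 1) (hcat 0 0))
           (vcat (hcat \<A> (hcat \<B> (block_mat BGd 0 (B\<Psi>y ** DGd) B\<Psi>y)))
           (vcat (hcat \<C> (hcat \<D> (hcat (D\<Psi>y ** DGd) D\<Psi>y)))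
                 (hcat 0 (hcat 0 (mat 1)))))"
    and LMI: "\<And>\<Gamma> \<gamma>. LMI \<Gamma> \<gamma> \<longleftrightarrow>
        neg_def (transpose N **
          block_diag (- (\<rho>\<^sup>2 *\<^sub>R P)) (block_diag P (block_diag M (- block_diag (\<gamma> *\<^sub>R \<Xi>) \<Gamma>))) ** N)"
  shows "pos_def Pcal \<and> pos_semidef Pdiff \<and>
    (\<exists>\<Gamma> \<gamma>. pos_def \<Gamma> \<and> \<gamma> > 0 \<and> LMI \<Gamma> \<gamma>) \<and>
    (\<forall>\<Gamma> \<gamma>. pos_def \<Gamma> \<and> \<gamma> > 0 \<and> LMI \<Gamma> \<gamma> \<longrightarrow>
      (\<forall>d \<xi>0 v x0 \<xi> r x y w e u.
        (\<forall>t. d t \<in> disturbance_set \<Xi> dmax) \<longrightarrow>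
        nominal_signals A BGu C DGu \<xi>0 v \<xi> r \<longrightarrow>
        (\<forall>t k. e k t = x k t - \<xi> k t) \<longrightarrow>
        (\<forall>t k. u k t = v k t + K *v e k t) \<longrightarrow>
        true_signals A BGw BGd BGu C DGw DGd DGu \<Delta> d x0 u x y w \<longrightarrow>
        (\<forall>t k. wnorm_sq Pcal (e k t) \<le> error_bound \<rho> \<gamma> dmax \<Gamma> P11 Pcal Pdiff e r k t)))"
proof -
  let ?Z = "\<lambda>\<Gamma> \<gamma>. transpose N **
    block_diag (- (\<rho>\<^sup>2 *\<^sub>R P)) (block_diag P (block_diag M (- block_diag (\<gamma> *\<^sub>R \<Xi>) \<Gamma>))) ** N"
  have symP: "symmetric_mat P" using P by (simp add: pos_def_def)
  have P': "pos_def (block_mat P11 (transpose P21) P21 P22)" using P P_partition by simp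
  note P22 = pos_def_block_matD(2)[OF P']

  \<comment> \<open>The matrix inequality read as a dissipation inequality for one step: storage
    after, supply and discounted storage before, with \<open>d\<close> and the nominal output
    \<open>r\<close> as external inputs.\<close>
  have form_N: "wnorm_sq (?Z \<Gamma> \<gamma>) (vjoin z (vjoin w (vjoin d r))) =
      - (\<rho>\<^sup>2 * wnorm_sq P z)
      + wnorm_sq P (\<A> *v z + \<B> *v w + vjoin (BGd *v d) (B\<Psi>y *v (DGd *v d) + B\<Psi>y *v r))
      + wnorm_sq M (\<C> *v z + \<D> *v w + (D\<Psi>y *v (DGd *v d) + D\<Psi>y *v r))
      - \<gamma> * wnorm_sq \<Xi> d - wnorm_sq \<Gamma> r" for \<Gamma> \<gamma> z w d r
    unfolding wnorm_sq_congruence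
    by (simp add: N wnorm_sq_block_diag wnorm_sq_uminus wnorm_sq_scaleR matrix_vector_mul_assoc add.assoc)
  have form_L: "wnorm_sq (transpose L ** block_diag (- (\<rho>\<^sup>2 *\<^sub>R P)) (block_diag P M) ** L) (vjoin z w) =
      - (\<rho>\<^sup>2 * wnorm_sq P z) + wnorm_sq P (\<A> *v z + \<B> *v w) + wnorm_sq M (\<C> *v z + \<D> *v w)" for z w
    unfolding wnorm_sq_congruence
    by (simp add: L wnorm_sq_block_diag wnorm_sq_uminus wnorm_sq_scaleR)

  \<comment> \<open>Existence of the multipliers\<close>
  have exists: "\<exists>\<Gamma> \<gamma>. pos_def \<Gamma> \<and> \<gamma> > 0 \<and> LMI \<Gamma> \<gamma>"
  proof -
    \<comment> \<open>This form measures only the external inputs. Where it vanishes,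
      \<open>d\<close> and \<open>r\<close> are zero, and the inequality without multipliers,
      \<open>?Z 0 0\<close>, reduces to the one in Assumption (U).\<close>
    define Y where "Y = block_diag (0 :: real^('nx + 'ns)^('nx + 'ns))
      (block_diag (0 :: real^'nw^'nw) (block_diag \<Xi> (mat 1 :: real^'ny^'ny)))"
    have form_Y: "wnorm_sq Y (vjoin z (vjoin w (vjoin d r))) = wnorm_sq \<Xi> d + r \<bullet> r" for z w d r
      unfolding Y_def wnorm_sq_block_diag by (simp add: wnorm_sq_def)
    have "wnorm_sq Y x \<ge> 0" for x
    proof -
      obtain z w d r where "x = vjoin z (vjoin w (vjoin d r))" by (metis vjoin_surj)
      then show ?thesis by (simp add: form_Y pos_def_wnorm_sq_nonneg[OF \<Xi>])
    qed
    moreover have "wnorm_sq (?Z 0 0) x < 0" if "x \<noteq> 0" "wnorm_sq Y x = 0" for x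
    proof -
      obtain z w d r where x: "x = vjoin z (vjoin w (vjoin d r))" by (metis vjoin_surj)
      have "wnorm_sq \<Xi> d = 0 \<and> r \<bullet> r = 0"
        using that(2) unfolding x form_Y
        by (smt (verit) inner_ge_zero pos_def_wnorm_sq_nonneg[OF \<Xi>])
      then have [simp]: "r = 0" "d = 0"
        using pos_def_wnorm_sq_pos[OF \<Xi>, of d] by auto
      have "vjoin z w \<noteq> 0" using that(1) by (simp add: x vjoin_eq_0_iff)
      then have "wnorm_sq (transpose L ** block_diag (- (\<rho>\<^sup>2 *\<^sub>R P)) (block_diag P M) ** L) (vjoin z w) < 0"
        using U unfolding neg_def_def wnorm_sq_def by blast
      moreover have "vjoin 0 0 = (0 :: real^('nx + 'ns))" by (simp add: vjoin_eq_0_iff)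
      ultimately show ?thesis unfolding x form_N form_L by (simp add: wnorm_sq_def)
    qed
    ultimately obtain c where c: "c > 0" "\<And>x. x \<noteq> 0 \<Longrightarrow> wnorm_sq (?Z 0 0) x < c * wnorm_sq Y x"
      using dominate_quadratic_form[of Y "?Z 0 0"] by blast
    \<comment> \<open>One constant serves both multipliers: with \<open>\<gamma> = c\<close> and
      this \<open>\<Gamma>\<close>, the multiplier block contributes exactly \<open>- c\<close>
      times the form \<open>Y\<close>.\<close>
    define \<Gamma> :: "real^'ny^'ny" where "\<Gamma> = c *\<^sub>R mat 1"
    have \<Gamma>_form: "wnorm_sq \<Gamma> r = c * (r \<bullet> r)" for r
      unfolding \<Gamma>_def wnorm_sq_scaleR by (simp add: wnorm_sq_def)
    have \<Gamma>_sym: "symmetric_mat \<Gamma>"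
      unfolding \<Gamma>_def by (intro symmetric_scaleR) (simp add: symmetric_mat_def transpose_mat)
    have "pos_def \<Gamma>"
      using \<Gamma>_sym \<Gamma>_form c(1) by (simp add: pos_def_def wnorm_sq_def)
    moreover have "LMI \<Gamma> c"
    proof -
      have "symmetric_mat (?Z \<Gamma> c)"
        using symP M \<Gamma>_sym \<Xi>
        by (intro symmetric_congruence symmetric_block_diag symmetric_uminus symmetric_scaleR)
          (simp_all add: pos_def_def)
      moreover have "wnorm_sq (?Z \<Gamma> c) x < 0" if "x \<noteq> 0" for x
      proof -
        obtain z w d r where x: "x = vjoin z (vjoin w (vjoin d r))" by (metis vjoin_surj)
        have "wnorm_sq (?Z \<Gamma> c) x = wnorm_sq (?Z 0 0) x - c * wnorm_sq Y x"
          unfolding x form_N form_Y \<Gamma>_form by (simp add: wnorm_sq_def algebra_simps)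
        then show ?thesis using c(2)[OF that] by simp
      qed
      ultimately show ?thesis unfolding LMI neg_def_def wnorm_sq_def by blast
    qed
    ultimately show ?thesis using c(1) by blast
  qed

  \<comment> \<open>The error bound along all predictions\<close>
  have bound: "wnorm_sq Pcal (e k t) \<le> error_bound \<rho> \<gamma> dmax \<Gamma> P11 Pcal Pdiff e r k t"
    if \<gamma>: "\<gamma> > 0" and lmi: "LMI \<Gamma> \<gamma>"
      and d: "\<And>t. d t \<in> disturbance_set \<Xi> dmax"
      and nominal: "nominal_signals A BGu C DGu \<xi>0 v \<xi> r"
      and e: "\<And>t k. e k t = x k t - \<xi> k t" and u: "\<And>t k. u k t = v k t + K *v e k t"
      and true: "true_signals A BGw BGd BGu C DGw DGd DGu \<Delta> d x0 u x y w"
    for \<Gamma> \<gamma> d \<xi>0 v x0 \<xi> r x y w e u k t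
  proof -
    let ?s = "error_bound \<rho> \<gamma> dmax \<Gamma> P11 Pcal Pdiff e r"
    \<comment> \<open>From here on, each \<open>t\<close> has its own output sequence in absolute
      time, so that filter, IQC and causality apply to an ordinary sequence; prediction step
      \<open>k\<close> sits at index \<open>t + k\<close>.\<close>
    define Y where "Y t = predicted_seq y t" for t
    define \<psi> where "\<psi> t = filter_state A\<Psi> B\<Psi>y B\<Psi>w (Y t) (\<Delta> (Y t))" for t
    define p where "p t = filter_output A\<Psi> B\<Psi>y B\<Psi>w C\<Psi> D\<Psi>y D\<Psi>w (Y t) (\<Delta> (Y t))" for t
    define Q where "Q t = acc_supply \<rho> (\<lambda>j. wnorm_sq M (p t j))" for t
    have Q_nonneg: "Q t j \<ge> 0" for t j
      unfolding Q_def p_def by (rule acc_supply_nonneg[OF iqc \<rho>(1)])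
    have Y: "Y t (t + k) = y k t" and w: "\<Delta> (Y t) (t + k) = w k t" for t k
      using true by (simp_all add: Y_def true_signals_def)
    \<comment> \<open>Subtracting the nominal dynamics cancels \<open>v\<close>, and the remaining
      input \<open>K *v e k t\<close> turns \<open>A\<close> into \<open>AG\<close>.\<close>
    have e_step: "e (Suc k) t = AG *v e k t + BGw *v w k t + BGd *v d (k + t)" for k t
      using nominal true unfolding nominal_signals_def true_signals_def e u AG
      by (simp add: algebra_simps matrix_vector_mul_assoc matrix_vector_mult_add_rdistrib
          matrix_vector_right_distrib matrix_vector_mult_diff_distrib)
    have y_eq: "y k t = CG *v e k t + DGw *v w k t + DGd *v d (k + t) + r k t" for k t
      using nominal true unfolding nominal_signals_def true_signals_def e u CG
      by (simp add: algebra_simps matrix_vector_mul_assoc matrix_vector_mult_add_rdistrib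
          matrix_vector_right_distrib matrix_vector_mult_diff_distrib)
    have \<psi>_step: "\<psi> t (t + Suc k) = A\<Psi> *v \<psi> t (t + k) + B\<Psi>y *v y k t + B\<Psi>w *v w k t" for k t
      by (simp add: \<psi>_def Y w)
    have p_state: "p t (t + k) = C\<Psi> *v \<psi> t (t + k) + D\<Psi>y *v y k t + D\<Psi>w *v w k t" for k t
      by (simp add: p_def filter_output_def \<psi>_def Y w)
    define z where "z k t = vjoin (e k t) (\<psi> t (t + k))" for k t
    have z_step: "z (Suc k) t = \<A> *v z k t + \<B> *v w k t +
        vjoin (BGd *v d (k + t)) (B\<Psi>y *v (DGd *v d (k + t)) + B\<Psi>y *v r k t)" for k t
      unfolding z_def \<psi>_step e_step y_eq \<A> \<B>
      by (simp add: vjoin_add algebra_simps matrix_vector_mult_add_rdistrib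
          matrix_vector_right_distrib flip: matrix_vector_mul_assoc)
    have p_eq: "p t (t + k) = \<C> *v z k t + \<D> *v w k t +
        (D\<Psi>y *v (DGd *v d (k + t)) + D\<Psi>y *v r k t)" for k t
      unfolding z_def p_state y_eq \<C> \<D>
      by (simp add: algebra_simps matrix_vector_mult_add_rdistrib
          matrix_vector_right_distrib flip: matrix_vector_mul_assoc)
    have d_le: "wnorm_sq \<Xi> (d t) \<le> dmax\<^sup>2" for t
      using d[of t] dmax by (simp add: disturbance_set_def wnorm_def sqrt_le_D)
    have step: "wnorm_sq P (z (Suc k) t) + Q t (t + Suc k) \<le>
        \<rho>\<^sup>2 * (wnorm_sq P (z k t) + Q t (t + k)) + \<gamma> * dmax\<^sup>2 + wnorm_sq \<Gamma> (r k t)" for k t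
    proof -
      \<comment> \<open>Only the non-strict inequality is available, because the combined vector of
        signals may be zero.\<close>
      have "wnorm_sq (?Z \<Gamma> \<gamma>) (vjoin (z k t) (vjoin (w k t) (vjoin (d (k + t)) (r k t)))) \<le> 0"
        using lmi unfolding LMI neg_def_def wnorm_sq_def
        by (metis inner_zero_left less_eq_real_def)
      then have "wnorm_sq P (z (Suc k) t) + wnorm_sq M (p t (t + k)) \<le>
          \<rho>\<^sup>2 * wnorm_sq P (z k t) + \<gamma> * wnorm_sq \<Xi> (d (k + t)) + wnorm_sq \<Gamma> (r k t)"
        unfolding form_N z_step p_eq by simp
      moreover have "\<gamma> * wnorm_sq \<Xi> (d (k + t)) \<le> \<gamma> * dmax\<^sup>2"
        using \<gamma> d_le by simp
      moreover have "Q t (t + Suc k) = \<rho>\<^sup>2 * Q t (t + k) + wnorm_sq M (p t (t + k))"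
        by (simp add: Q_def)
      ultimately show ?thesis by (simp add: algebra_simps)
    qed
    have propagate: "wnorm_sq P (z k t) + Q t (t + k) \<le> ?s k t"
      if "wnorm_sq P (z 0 t) + Q t t \<le> ?s 0 t" for k t
    proof (induction k)
      case (Suc k)
      have "\<rho>\<^sup>2 * (wnorm_sq P (z k t) + Q t (t + k)) \<le> \<rho>\<^sup>2 * ?s k t"
        using Suc by (intro mult_left_mono) simp_all
      then show ?case using step[of k t] by simp
    qed (use that in simp)
    \<comment> \<open>Induction over the time of prediction: \<open>propagate\<close> carries the
      bound one step ahead, and \<open>storage_reset\<close> transfers it to the start of the next
      prediction.\<close>
    have "wnorm_sq P (z 0 t) + Q t t \<le> ?s 0 t" for t
    proof (induction t)
      case 0
      \<comment> \<open>The filter starts at zero and no supply has accumulated, so only the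
        \<open>P11\<close> part of the storage remains.\<close>
      show ?case by (simp add: z_def \<psi>_def Q_def P_partition wnorm_sq_def)
    next
      case (Suc t)
      \<comment> \<open>Consecutive sequences agree up to time \<open>t\<close> and may differ from
        \<open>t + 1\<close> on, since a new nominal trajectory changes the input. Agreement up to
        \<open>t\<close> is just enough for the filter state and the supply at
        \<open>Suc t\<close>.\<close>
      have same: "Y (Suc t) j = Y t j \<and> \<Delta> (Y (Suc t)) j = \<Delta> (Y t) j" if "j \<le> t" for j
      proof -
        have "\<forall>i\<le>t. Y (Suc t) i = Y t i" by (simp add: Y_def predicted_seq_Suc)
        then show ?thesis using \<Delta>(1) that unfolding causal_op_def by blast
      qed
      then have \<psi>: "\<psi> (Suc t) (Suc t) = \<psi> t (Suc t)"
        unfolding \<psi>_def by (intro filter_state_cong) simp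
      have Q: "Q (Suc t) (Suc t) = Q t (Suc t)"
        unfolding Q_def p_def
        by (intro acc_supply_cong arg_cong[where f = "wnorm_sq M"] filter_output_cong) (simp add: same)
      have "wnorm_sq P (vjoin (e 1 t) (\<psi> t (Suc t))) + Q t (Suc t) \<le> ?s 1 t"
        using propagate[OF Suc, of 1] by (simp add: z_def)
      from storage_reset[OF P' Pcal Pdiff this[unfolded P_partition] Q_nonneg, of "e 0 (Suc t)"]
      have "wnorm_sq P (vjoin (e 0 (Suc t)) (\<psi> t (Suc t))) + Q t (Suc t) \<le> ?s 0 (Suc t)"
        by (simp add: P_partition)
      then show ?case by (simp add: z_def \<psi> Q)
    qed
    then have "wnorm_sq P (z k t) + Q t (t + k) \<le> ?s k t" by (rule propagate)
    \<comment> \<open>The Schur complement split discards the square of the shifted filter state;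
      the nonnegative supply is dropped afterwards.\<close>
    moreover have "wnorm_sq P (z k t) \<ge> wnorm_sq Pcal (e k t)"
      unfolding z_def P_partition schur_complement_split[OF P22 refl] Pcal
      by (simp add: pos_def_wnorm_sq_nonneg[OF P22])
    ultimately show ?thesis using Q_nonneg[of t "t + k"] by linarith
  qed

  have "pos_def Pcal" unfolding Pcal by (rule pos_def_schur_complement[OF P'])
  moreover have "pos_semidef Pdiff"
    unfolding Pdiff Pcal schur_complement_diff[OF P22 refl]
    by (simp add: pos_semidef_congruence[OF P22])
  ultimately show ?thesis
    using exists by (intro conjI allI impI) (blast | rule bound; blast)+
qed

end
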